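(* For $n\ge1$ let $v_n(p,q):=\sum_{w\in\mathcal F_{n,2}}p^{\mathrm{edg}(G(w))}q^{\mathrm{ver}(G(w))}$. Then for all $n\ge3$, $$v_n(p,q)=p^3q^2v_{n-1}(p,q)+p^9q^6v_{n-2}(p,q),$$ with $v_1(p,q)=p^4q^4+p^7q^6$ and $v_2(p,q)=p^7q^6+2p^{10}q^8$. Moreover, for all $n\ge1$, $$v_n(p,q)=\sum_{i=0}^{\lfloor (n+1)/2\rfloor}\binom{n+1-i}{i}p^{3n+1+3i}q^{2n+2+2i}.$$
   Context: $\mathcal F_{n,2}$ is the set of binary words $w=w_1\cdots w_n$ with no two consecutive $1$'s. $P(w)$ is the bargraph polyomino formed by the unit squares $[i-1,i]\times[j-1,j]$, $1\le i\le n$, $1\le j\le w_i+1$. $G(w)$ is the graph whose vertices are the corners of the cells of $P(w)$ and whose edges are the cell sides. $\mathrm{ver}(G)$ and $\mathrm{edg}(G)$ denote the numbers of vertices and edges of $G$. *)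

theory Defs
  imports Complex_Main
begin

text \<open>The binary words of length \<open>n\<close> without two consecutive ones.  The letter \<open>w\<^sub>i\<close>,
  \<open>1 \<le> i \<le> n\<close>, is the list entry \<open>w ! (i - 1)\<close>.\<close>

definition fib_words :: "nat \<Rightarrow> nat list set" where
  "fib_words n = {w. length w = n \<and> set w \<subseteq> {0, 1} \<and>
     (\<forall>i. Suc i < n \<longrightarrow> \<not> (w ! i = 1 \<and> w ! Suc i = 1))}"

text \<open>The pair \<open>(i, j)\<close> with \<open>i, j \<ge> 1\<close> stands for the unit square \<open>[i-1,i] \<times> [j-1,j]\<close>.\<close>

type_synonym cell = "nat \<times> nat"

type_synonym point = "nat \<times> nat"

definition bargraph :: "nat list \<Rightarrow> cell set" where
  "bargraph w = {(i, j). 1 \<le> i \<and> i \<le> length w \<and> 1 \<le> j \<and> j \<le> w ! (i - 1) + 1}"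

definition cell_corners :: "cell \<Rightarrow> point set" where
  "cell_corners = (\<lambda>(i, j). {(i - 1, j - 1), (i, j - 1), (i - 1, j), (i, j)})"

definition cell_sides :: "cell \<Rightarrow> point set set" where
  "cell_sides = (\<lambda>(i, j).
     {{(i - 1, j - 1), (i, j - 1)}, {(i - 1, j), (i, j)},
      {(i - 1, j - 1), (i - 1, j)}, {(i, j - 1), (i, j)}})"

text \<open>A graph is a pair of a vertex set and a set of undirected edges, an edge being the set of
  its two endpoints.\<close>

type_synonym graph = "point set \<times> point set set"

definition bargraph_graph :: "nat list \<Rightarrow> graph" where
  "bargraph_graph w =
     (\<Union>c \<in> bargraph w. cell_corners c, \<Union>c \<in> bargraph w. cell_sides c)"

definition ver :: "graph \<Rightarrow> nat" where
  "ver G = card (fst G)"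

definition edg :: "graph \<Rightarrow> nat" where
  "edg G = card (snd G)"

text \<open>The arguments \<open>p\<close> and \<open>q\<close> range over an arbitrary commutative semiring; the bivariate
  generating polynomial itself is the instance at the two indeterminates of a polynomial ring.\<close>

definition v :: "nat \<Rightarrow> 'a::comm_semiring_1 \<Rightarrow> 'a \<Rightarrow> 'a" where
  "v n p q = (\<Sum>w \<in> fib_words n.
     p ^ edg (bargraph_graph w) * q ^ ver (bargraph_graph w))"

end

theory Submission
  imports Defs
begin

text \<open>A word of length \<open>n \<ge> 1\<close> with \<open>k\<close> isolated ones has a graph with \<open>3n + 1 + 3k\<close> edges and
  \<open>2n + 2 + 2k\<close> vertices: append the columns one at a time, and observe that a new side is an old
  edge only if it joins two old vertices, which happens for the lowest vertical side alone.  Hence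
  \<open>v n p q = p^(3n+1) q^(2n+2) f\<^sub>n(p^3 q^2)\<close>, where \<open>f\<^sub>n(x)\<close> counts the words by their number of
  ones.  Splitting off the suffix \<open>0\<close> or \<open>01\<close> gives \<open>f\<^sub>n = f\<^sub>n\<^sub>-\<^sub>1 + x f\<^sub>n\<^sub>-\<^sub>2\<close>, and the binomial sum
  satisfies the same recurrence by Pascal's rule.\<close>

section \<open>Words without consecutive ones and their suffixes\<close>

lemma fib_words_0: "fib_words 0 = {[]}"
  by (auto simp: fib_words_def)

lemma fib_words_1: "fib_words 1 = {[0], [1]}"
  by (auto simp: fib_words_def length_Suc_conv)

lemma snoc_in_fib_wordsD: "w @ [a] \<in> fib_words (Suc n) \<Longrightarrow> w \<in> fib_words n \<and> a \<in> {0, 1}"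
proof
  assume w: "w @ [a] \<in> fib_words (Suc n)"
  then have "\<not> (w ! i = 1 \<and> w ! Suc i = 1)" if "Suc i < n" for i
    using that by (auto simp: fib_words_def nth_append dest!: spec[of _ i])
  with w show "w \<in> fib_words n" by (simp add: fib_words_def)
qed (auto simp: fib_words_def)

lemma snoc_0_in_fib_words_iff: "w @ [0] \<in> fib_words (Suc n) \<longleftrightarrow> w \<in> fib_words n"
proof
  assume "w \<in> fib_words n"
  then show "w @ [0] \<in> fib_words (Suc n)"
    by (auto simp: fib_words_def nth_append)
qed (use snoc_in_fib_wordsD in blast)

lemma snoc_01_in_fib_words_iff: "w @ [0, 1] \<in> fib_words (Suc (Suc n)) \<longleftrightarrow> w \<in> fib_words n"
proof
  assume "w \<in> fib_words n"
  then show "w @ [0, 1] \<in> fib_words (Suc (Suc n))"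
    by (auto simp: fib_words_def nth_append nth_Cons')
next
  assume "w @ [0, 1] \<in> fib_words (Suc (Suc n))"
  then have "(w @ [0]) @ [1] \<in> fib_words (Suc (Suc n))" by simp
  then show "w \<in> fib_words n" using snoc_in_fib_wordsD by blast
qed

lemma not_snoc_11_in_fib_words: "w @ [1, 1] \<notin> fib_words n"
proof
  assume *: "w @ [1, 1] \<in> fib_words n"
  then have "Suc (length w) < n" by (auto simp: fib_words_def)
  with * show False by (auto simp: fib_words_def nth_append)
qed

text \<open>A final 1 must be preceded by 0, so exactly one of the suffixes \<open>0\<close> and
  \<open>01\<close> can be split off, and appending either one never creates two adjacent
  ones.\<close>

lemma fib_words_Suc_Suc:
  "fib_words (Suc (Suc n)) =
     (\<lambda>w. w @ [0]) ` fib_words (Suc n) \<union> (\<lambda>w. w @ [0, 1]) ` fib_words n"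
proof (intro equalityI subsetI)
  fix w assume w: "w \<in> fib_words (Suc (Suc n))"
  then have "length w = Suc (Suc n)" by (simp add: fib_words_def)
  then obtain u b a where "w = (u @ [b]) @ [a]"
    by (metis length_Suc_conv_rev)
  moreover from this w have "u @ [b] \<in> fib_words (Suc n)" "a \<in> {0, 1}"
    using snoc_in_fib_wordsD by blast+
  moreover from this have "b \<in> {0, 1}" "u \<in> fib_words n"
    using snoc_in_fib_wordsD by blast+
  \<comment> \<open>This rules out \<open>a = b = 1\<close>: either \<open>a = 0\<close>, or
    \<open>a = 1\<close> and then \<open>b = 0\<close>.\<close>
  moreover have "u @ [1, 1] \<notin> fib_words (Suc (Suc n))"
    by (rule not_snoc_11_in_fib_words)
  ultimately show "w \<in> (\<lambda>w. w @ [0]) ` fib_words (Suc n) \<union> (\<lambda>w. w @ [0, 1]) ` fib_words n"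
    using w by auto
qed (use snoc_0_in_fib_words_iff snoc_01_in_fib_words_iff in blast)

lemma finite_fib_words: "finite (fib_words n)"
proof (rule finite_subset)
  show "fib_words n \<subseteq> {w. set w \<subseteq> {0, 1} \<and> length w = n}"
    by (auto simp: fib_words_def)
qed (simp add: finite_lists_length_eq)

section \<open>Growth of the graph when a column is appended\<close>

definition vertices :: "nat list \<Rightarrow> point set" where
  "vertices w = (\<Union>c \<in> bargraph w. cell_corners c)"

definition edges :: "nat list \<Rightarrow> point set set" where
  "edges w = (\<Union>c \<in> bargraph w. cell_sides c)"

lemma bargraph_Nil: "bargraph [] = {}"
  by (auto simp: bargraph_def)

lemma bargraph_snoc:
  "bargraph (w @ [a]) = bargraph w \<union> {Suc (length w)} \<times> {1..Suc a}"
proof -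
  have "(i, j) \<in> bargraph (w @ [a]) \<longleftrightarrow>
      (i, j) \<in> bargraph w \<union> {Suc (length w)} \<times> {1..Suc a}" for i j
    by (cases "i = Suc (length w)") (auto simp: bargraph_def nth_append)
  then show ?thesis by auto
qed

lemma finite_bargraph: "finite (bargraph w)"
proof (induction w rule: rev_induct)
  case Nil
  show ?case by (simp add: bargraph_Nil)
next
  case (snoc a w)
  then show ?case by (simp add: bargraph_snoc)
qed

lemma finite_vertices: "finite (vertices w)"
  unfolding vertices_def by (intro finite_UN_I finite_bargraph) (auto simp: cell_corners_def)

lemma finite_edges: "finite (edges w)"
  unfolding edges_def by (intro finite_UN_I finite_bargraph) (auto simp: cell_sides_def)

lemma column_simps: "{1..Suc 0} = {1}" "{1..Suc 1} = {1, 2}"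
  by auto

lemma vertices_snoc:
  "vertices (w @ [a]) = vertices w \<union> (\<Union>j \<in> {1..Suc a}. cell_corners (Suc (length w), j))"
  unfolding vertices_def bargraph_snoc by auto

lemma edges_snoc:
  "edges (w @ [a]) = edges w \<union> (\<Union>j \<in> {1..Suc a}. cell_sides (Suc (length w), j))"
  unfolding edges_def bargraph_snoc by auto

lemma vertex_bound: "(x, y) \<in> vertices w \<Longrightarrow> x \<le> length w"
  by (auto simp: vertices_def bargraph_def cell_corners_def)

lemma vertex_last_column_bound: "(Suc (length w), y) \<in> vertices (w @ [a]) \<Longrightarrow> y \<le> Suc a"
  by (auto simp: vertices_snoc cell_corners_def dest: vertex_bound)

text \<open>Serves as a test for new edges: a side with an endpoint outside
  \<open>vertices w\<close> cannot lie in \<open>edges w\<close>.\<close>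

lemma edge_subset_vertices: "e \<in> edges w \<Longrightarrow> e \<subseteq> vertices w"
proof -
  have "e \<subseteq> cell_corners c" if "e \<in> cell_sides c" for c
    using that by (auto simp: cell_corners_def cell_sides_def split: prod.splits)
  then show "e \<in> edges w \<Longrightarrow> e \<subseteq> vertices w"
    by (auto simp: vertices_def edges_def)
qed

text \<open>Every column has height \<open>w_i + 1 \<ge> 1\<close>, so the lowest right side of the
  last column is always present. It is the side shared with the next column.\<close>

lemma right_side:
  assumes "w \<noteq> []"
  shows "(length w, 0) \<in> vertices w" "(length w, 1) \<in> vertices w"
    "{(length w, 0), (length w, 1)} \<in> edges w"
proof -
  have "(length w, 1) \<in> bargraph w"
    using assms by (auto simp: bargraph_def Suc_le_eq)
  then have "cell_corners (length w, 1) \<subseteq> vertices w" "cell_sides (length w, 1) \<subseteq> edges w"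
    unfolding vertices_def edges_def by blast+
  then show "(length w, 0) \<in> vertices w" "(length w, 1) \<in> vertices w"
    "{(length w, 0), (length w, 1)} \<in> edges w"
    by (simp_all add: cell_corners_def cell_sides_def)
qed

lemma card_vertices_snoc_0:
  assumes "w \<noteq> []"
  shows "card (vertices (w @ [0])) = card (vertices w) + 2"
proof -
  let ?N = "{(Suc (length w), 0), (Suc (length w), 1)}"
  have "vertices (w @ [0]) = vertices w \<union> ?N"
    using right_side[OF assms] by (auto simp: vertices_snoc cell_corners_def)
  moreover have "vertices w \<inter> ?N = {}"
    by (auto dest: vertex_bound)
  ultimately show ?thesis
    by (simp add: card_Un_disjoint finite_vertices)
qed

lemma card_edges_snoc_0:
  assumes "w \<noteq> []"
  shows "card (edges (w @ [0])) = card (edges w) + 3"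
proof -
  let ?m = "length w"
  let ?N = "{{(?m, 0), (Suc ?m, 0)}, {(?m, 1), (Suc ?m, 1)}, {(Suc ?m, 0), (Suc ?m, 1)}} :: point set set"
  have "edges (w @ [0]) = edges w \<union> ?N"
    using right_side[OF assms] by (auto simp: edges_snoc cell_sides_def)
  \<comment> \<open>Each new side has an endpoint with abscissa \<open>Suc ?m\<close>, to the right
    of the old graph.\<close>
  moreover have "(Suc ?m, y) \<notin> vertices w" for y
    by (auto dest: vertex_bound)
  then have "edges w \<inter> ?N = {}"
    by (auto dest!: edge_subset_vertices)
  moreover have "card ?N = 3"
    by (simp add: card_insert_if doubleton_eq_iff)
  ultimately show ?thesis
    by (simp only: card_Un_disjoint finite_edges finite.intros)
qed

text \<open>The last letter 0 gives the old right boundary height 1, so \<open>(length w, 2)\<close>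
  is a new vertex. After a last letter 1 it would already be present.\<close>

lemma card_vertices_snoc_1:
  assumes "w = u @ [0]"
  shows "card (vertices (w @ [1])) = card (vertices w) + 4"
proof -
  let ?m = "length w"
  let ?N = "{(?m, 2), (Suc ?m, 0), (Suc ?m, 1), (Suc ?m, 2)}"
  have "w \<noteq> []" using assms by simp
  then have "vertices (w @ [1]) = vertices w \<union> ?N"
    using right_side[of w]
    unfolding vertices_snoc column_simps by (auto simp: cell_corners_def numeral_2_eq_2)
  moreover have "vertices w \<inter> ?N = {}"
    using vertex_last_column_bound[of u 2 0] assms by (auto dest: vertex_bound)
  ultimately show ?thesis
    by (simp add: card_Un_disjoint finite_vertices)
qed

lemma card_edges_snoc_1:
  assumes "w = u @ [0]"
  shows "card (edges (w @ [1])) = card (edges w) + 6"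
proof -
  let ?m = "length w"
  let ?N = "{{(?m, 0), (Suc ?m, 0)}, {(?m, 1), (Suc ?m, 1)}, {(?m, 2), (Suc ?m, 2)},
    {(Suc ?m, 0), (Suc ?m, 1)}, {(Suc ?m, 1), (Suc ?m, 2)}, {(?m, 1), (?m, 2)}} :: point set set"
  have "w \<noteq> []" using assms by simp
  then have "edges (w @ [1]) = edges w \<union> ?N"
    using right_side[of w]
    unfolding edges_snoc column_simps by (auto simp: cell_sides_def numeral_2_eq_2)
  \<comment> \<open>The left side of the upper cell lies on the old right boundary line; it is new
    because its endpoint \<open>(?m, 2)\<close> is. The other five sides reach abscissa
    \<open>Suc ?m\<close>.\<close>
  moreover have "(?m, 2) \<notin> vertices w" "\<And>y. (Suc ?m, y) \<notin> vertices w"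
    using vertex_last_column_bound[of u 2 0] assms by (auto dest: vertex_bound)
  then have "edges w \<inter> ?N = {}"
    by (auto dest!: edge_subset_vertices)
  moreover have "card ?N = 6"
    by (simp add: card_insert_if doubleton_eq_iff)
  ultimately show ?thesis
    by (simp only: card_Un_disjoint finite_edges finite.intros)
qed

lemma card_vertices_edges_single:
  "card (vertices [0]) = 4" "card (edges [0]) = 4"
  "card (vertices [1]) = 6" "card (edges [1]) = 7"
proof -
  have "bargraph [0] = {(1, 1)}" "bargraph [1] = {(1, 1), (1, 2)}"
    using bargraph_snoc[of "[]" 0] bargraph_snoc[of "[]" 1]
    by (auto simp: bargraph_Nil column_simps)
  then show "card (vertices [0]) = 4" "card (edges [0]) = 4"
    "card (vertices [1]) = 6" "card (edges [1]) = 7"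
    by (simp_all add: vertices_def edges_def cell_corners_def cell_sides_def
        card_insert_if doubleton_eq_iff)
qed

text \<open>The empty word has an empty graph and does not fit the formulas, so the induction
  effectively starts with the words of length 1.\<close>

lemma card_vertices_edges:
  assumes "w \<in> fib_words n" "n \<ge> 1"
  shows "card (vertices w) = 2 * n + 2 + 2 * sum_list w \<and>
    card (edges w) = 3 * n + 1 + 3 * sum_list w"
  using assms
proof (induction w arbitrary: n rule: rev_induct)
  case Nil
  then show ?case by (simp add: fib_words_def)
next
  case (snoc a w)
  then obtain m where n: "n = Suc m" by (cases n) auto
  with snoc.prems have w: "w \<in> fib_words m" and a: "a \<in> {0, 1}"
    using snoc_in_fib_wordsD by blast+
  show ?case
  proof (cases m)
    case 0
    with w have "w = []" by (simp add: fib_words_0)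
    with a n 0 show ?thesis using card_vertices_edges_single by auto
  next
    case (Suc k)
    with w have "w \<noteq> []" by (auto simp: fib_words_def)
    have IH: "card (vertices w) = 2 * m + 2 + 2 * sum_list w"
      "card (edges w) = 3 * m + 1 + 3 * sum_list w"
      using snoc.IH[OF w] Suc by auto
    show ?thesis
    proof (cases "a = 0")
      case True
      with \<open>w \<noteq> []\<close> IH n show ?thesis
        by (simp add: card_vertices_snoc_0 card_edges_snoc_0)
    next
      case False
      with a have "a = 1" by simp
      \<comment> \<open>A word ending in 1 belongs to the \<open>01\<close> branch of the suffix
        decomposition.\<close>
      with snoc.prems n Suc obtain u where "w = u @ [0]"
        by (auto simp: fib_words_Suc_Suc)
      from card_vertices_snoc_1[OF this] card_edges_snoc_1[OF this] \<open>a = 1\<close> IH n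
      show ?thesis by simp
    qed
  qed
qed

section \<open>The generating polynomial by number of ones\<close>

definition ones_poly :: "nat \<Rightarrow> 'a::comm_semiring_1 \<Rightarrow> 'a" where
  "ones_poly n x = (\<Sum>w \<in> fib_words n. x ^ sum_list w)"

lemma ones_poly_0: "ones_poly 0 x = 1"
  by (simp add: ones_poly_def fib_words_0)

lemma ones_poly_1: "ones_poly (Suc 0) x = 1 + x"
  using fib_words_1 by (simp add: ones_poly_def)

text \<open>The two suffix classes are disjoint because their last letters differ. The suffix
  \<open>01\<close> adds one 1, hence the factor \<open>x\<close>.\<close>

lemma ones_poly_Suc_Suc:
  "ones_poly (Suc (Suc n)) x = ones_poly (Suc n) x + x * ones_poly n x"
proof -
  have "ones_poly (Suc (Suc n)) x =
      (\<Sum>w \<in> (\<lambda>w. w @ [0]) ` fib_words (Suc n). x ^ sum_list w) +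
      (\<Sum>w \<in> (\<lambda>w. w @ [0, 1]) ` fib_words n. x ^ sum_list w)"
    unfolding ones_poly_def fib_words_Suc_Suc
    by (intro sum.union_disjoint finite_imageI finite_fib_words) auto
  also have "\<dots> = ones_poly (Suc n) x + x * ones_poly n x"
    by (simp add: ones_poly_def sum.reindex inj_on_def sum_distrib_left)
  finally show ?thesis .
qed

lemma monomial_power:
  fixes p q :: "'a::comm_semiring_1"
  shows "(p ^ 3 * q ^ 2) ^ k = p ^ (3 * k) * q ^ (2 * k)"
  by (simp add: power_mult power_mult_distrib)

lemma v_eq_ones_poly:
  assumes "n \<ge> 1"
  shows "v n p q = p ^ (3 * n + 1) * q ^ (2 * n + 2) * ones_poly n (p ^ 3 * q ^ 2)"
proof -
  have "v n p q = (\<Sum>w \<in> fib_words n. p ^ card (edges w) * q ^ card (vertices w))"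
    by (simp add: v_def edg_def ver_def bargraph_graph_def vertices_def edges_def)
  also have "\<dots> = (\<Sum>w \<in> fib_words n.
      p ^ (3 * n + 1) * q ^ (2 * n + 2) * (p ^ 3 * q ^ 2) ^ sum_list w)"
  proof (rule sum.cong[OF refl])
    fix w assume "w \<in> fib_words n"
    then show "p ^ card (edges w) * q ^ card (vertices w) =
        p ^ (3 * n + 1) * q ^ (2 * n + 2) * (p ^ 3 * q ^ 2) ^ sum_list w"
      using card_vertices_edges[OF _ assms, of w]
      by (simp add: monomial_power power_add mult_ac)
  qed
  finally show ?thesis
    by (simp add: ones_poly_def sum_distrib_left)
qed

section \<open>Sums along the diagonals of Pascal's triangle\<close>

lemma diagonal_choose_sum_rec:
  fixes x :: "'a::comm_semiring_1"
  \<comment> \<open>The upper limit \<open>n + 1\<close> instead of \<open>(n + 1) div 2\<close>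
    avoids a parity distinction; the extra binomial coefficients vanish.\<close>
  defines "s \<equiv> \<lambda>n. \<Sum>i\<le>n + 1. of_nat ((n + 1 - i) choose i) * x ^ i"
  shows "s (Suc (Suc n)) = s (Suc n) + x * s n"
proof -
  have "s (Suc (Suc n)) = 1 + (\<Sum>j\<le>n + 2. of_nat ((n + 2 - j) choose Suc j) * x ^ Suc j)"
    by (simp add: s_def sum.atMost_Suc_shift del: sum.atMost_Suc)
  \<comment> \<open>The dropped term \<open>j = n + 2\<close> has coefficient
    \<open>0 choose (n + 3) = 0\<close>.\<close>
  also have "\<dots> = 1 + (\<Sum>j\<le>n + 1. of_nat ((n + 2 - j) choose Suc j) * x ^ Suc j)"
    by simp
  \<comment> \<open>Pascal's rule applies since \<open>n + 2 - j = Suc (n + 1 - j)\<close> for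
    \<open>j \<le> n + 1\<close>.\<close>
  also have "(\<Sum>j\<le>n + 1. of_nat ((n + 2 - j) choose Suc j) * x ^ Suc j) =
      (\<Sum>j\<le>n + 1. of_nat ((n + 1 - j) choose Suc j) * x ^ Suc j
        + x * (of_nat ((n + 1 - j) choose j) * x ^ j))"
    by (rule sum.cong) (simp_all add: Suc_diff_le algebra_simps)
  also have "1 + \<dots> = (1 + (\<Sum>j\<le>n + 1. of_nat ((n + 1 - j) choose Suc j) * x ^ Suc j)) + x * s n"
    by (simp add: s_def sum.distrib sum_distrib_left add_ac del: sum.atMost_Suc)
  \<comment> \<open>The index shift is undone: the leading 1 is the term \<open>i = 0\<close> of
    \<open>s (Suc n)\<close>.\<close>
  also have "1 + (\<Sum>j\<le>n + 1. of_nat ((n + 1 - j) choose Suc j) * x ^ Suc j) = s (Suc n)"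
    by (simp add: s_def sum.atMost_Suc_shift del: sum.atMost_Suc)
  finally show ?thesis .
qed

lemma ones_poly_eq_diagonal_choose_sum:
  "ones_poly n x = (\<Sum>i\<le>n + 1. of_nat ((n + 1 - i) choose i) * x ^ i)"
proof (induction n rule: less_induct)
  case (less n)
  consider "n = 0" | "n = 1" | m where "n = Suc (Suc m)"
    by (metis One_nat_def not0_implies_Suc)
  then show ?case
  proof cases
    case 3
    then show ?thesis
      using less.IH[of m] less.IH[of "Suc m"]
      by (simp only: ones_poly_Suc_Suc diagonal_choose_sum_rec)
  qed (simp_all add: ones_poly_0 ones_poly_1)
qed

lemma ones_poly_closed_form:
  "ones_poly n x = (\<Sum>i = 0..(n + 1) div 2. of_nat ((n + 1 - i) choose i) * x ^ i)"
  unfolding ones_poly_eq_diagonal_choose_sum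
  by (rule sum.mono_neutral_right) (auto simp: binomial_eq_0)

theorem theorem2p3:
  fixes p q :: "'a::comm_semiring_1"
  shows "(\<forall>n\<ge>3. v n p q = p ^ 3 * q ^ 2 * v (n - 1) p q + p ^ 9 * q ^ 6 * v (n - 2) p q) \<and>
    v 1 p q = p ^ 4 * q ^ 4 + p ^ 7 * q ^ 6 \<and>
    v 2 p q = p ^ 7 * q ^ 6 + 2 * p ^ 10 * q ^ 8 \<and>
    (\<forall>n\<ge>1. v n p q = (\<Sum>i = 0..(n + 1) div 2.
       of_nat ((n + 1 - i) choose i) * p ^ (3 * n + 1 + 3 * i) * q ^ (2 * n + 2 + 2 * i)))"
proof (intro conjI allI impI)
  fix n :: nat
  assume "n \<ge> 3"
  then obtain m where n: "n = Suc (Suc m)" and "m \<ge> 1"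
    by (metis One_nat_def Suc_le_D Suc_le_mono numeral_3_eq_3)
  \<comment> \<open>Two further letters multiply the monomial prefactor by \<open>p^6 q^4\<close>;
    the factor \<open>x = p^3 q^2\<close> of the recurrence raises this to
    \<open>p^9 q^6\<close>.\<close>
  have "p ^ (3 * n + 1) * q ^ (2 * n + 2) = p ^ 3 * q ^ 2 * (p ^ (3 * Suc m + 1) * q ^ (2 * Suc m + 2))"
    "p ^ (3 * n + 1) * q ^ (2 * n + 2) * (p ^ 3 * q ^ 2) =
       p ^ 9 * q ^ 6 * (p ^ (3 * m + 1) * q ^ (2 * m + 2))"
    unfolding n by (simp_all add: power_add eval_nat_numeral mult_ac)
  then show "v n p q = p ^ 3 * q ^ 2 * v (n - 1) p q + p ^ 9 * q ^ 6 * v (n - 2) p q"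
    using \<open>m \<ge> 1\<close> by (simp add: v_eq_ones_poly n ones_poly_Suc_Suc distrib_left mult.assoc[symmetric])
next
  show "v 1 p q = p ^ 4 * q ^ 4 + p ^ 7 * q ^ 6"
    by (simp add: v_eq_ones_poly ones_poly_1 distrib_left eval_nat_numeral mult_ac)
next
  have "ones_poly 2 x = 1 + 2 * x" for x :: 'a
    using ones_poly_Suc_Suc[of 0 x]
    by (simp add: eval_nat_numeral(2) ones_poly_0 ones_poly_1 mult_2 add_ac)
  then show "v 2 p q = p ^ 7 * q ^ 6 + 2 * p ^ 10 * q ^ 8"
    by (simp add: v_eq_ones_poly distrib_left eval_nat_numeral mult_ac)
next
  fix n :: nat
  assume "n \<ge> 1"
  then show "v n p q = (\<Sum>i = 0..(n + 1) div 2.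
      of_nat ((n + 1 - i) choose i) * p ^ (3 * n + 1 + 3 * i) * q ^ (2 * n + 2 + 2 * i))"
    unfolding v_eq_ones_poly[OF \<open>n \<ge> 1\<close>] ones_poly_closed_form sum_distrib_left
    by (intro sum.cong) (simp_all add: monomial_power power_add mult_ac)
qed

end
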